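(* Let $A\in\mathbb{R}^{n\times n}$ be symmetric with orthonormal eigenvectors $v_1,\ldots,v_n$ and corresponding eigenvalues satisfying $|\lambda_1|>|\lambda_2|>\cdots>|\lambda_n|>0$, and let $b\in\mathbb{R}^n$ satisfy $v_j^Tb\ne0$ for $j=1,\ldots,n$. Run the symmetric Lanczos process for $A$ with starting vector $q_1=Ab/\|Ab\|$ to completion, producing diagonal entries $\alpha_1,\ldots,\alpha_n$ and positive off-diagonal entries $\beta_1,\ldots,\beta_{n-1}$, and let $Q_k,Q_{k+1},T_k$ be the matrices generated after $k$ steps. Let $\gamma_k=\|A-Q_{k+1}T_kQ_k^T\|$. Then for $k=1,2,\ldots,n-2$, $$\beta_{k+1}\le\gamma_k,\qquad |\alpha_{k+2}|\le\gamma_k.$$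
   Context: $\|\cdot\|$ is the 2-norm of a vector or matrix. Symmetric Lanczos process: with $q_1=Ab/\|Ab\|$, for $k\le n-1$ the $k$-step process produces $Q_{k+1}=(q_1,\ldots,q_{k+1})$ with orthonormal columns, $Q_k=(q_1,\ldots,q_k)$, and $T_k\in\mathbb{R}^{(k+1)\times k}$ such that $AQ_k=Q_{k+1}T_k$. Here $T_k$ is tridiagonal with diagonal entries $\alpha_1,\ldots,\alpha_k$, subdiagonal entries $\beta_1,\ldots,\beta_k>0$ and superdiagonal entries $\beta_1,\ldots,\beta_{k-1}$; its first $k$ rows form a symmetric matrix. The columns of $Q_k$ form an orthonormal basis of $\mathcal{K}_k(A,Ab)=\mathrm{span}\{Ab,A^2b,\ldots,A^kb\}$. Under the assumptions on $A$ and $b$ the process runs for $n$ steps without breakdown ($\beta_k>0$ for $k=1,\ldots,n-1$, and $\beta_n=0$), so that $Q_n^TAQ_n$ is the symmetric tridiagonal matrix with diagonal $\alpha_1,\ldots,\alpha_n$ and off-diagonal entries $\beta_1,\ldots,\beta_{n-1}$, where $Q_n$ is orthogonal. *)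

theory Defs
  imports Complex_Main "Jordan_Normal_Form.Char_Poly"
begin

definition vec_norm2 :: "real vec \<Rightarrow> real" where
  "vec_norm2 v = sqrt (v \<bullet> v)"

definition mat_norm2 :: "real mat \<Rightarrow> real" where
  "mat_norm2 M = Sup {vec_norm2 (M *\<^sub>v x) | x. x \<in> carrier_vec (dim_col M) \<and> vec_norm2 x \<le> 1}"

(* The symmetric Lanczos process for A with starting vector A b / ||A b||, with the
   vectors q_k and residuals r_k = A q_k - alpha_k q_k - beta_(k-1) q_(k-1) numbered from 1,
   and with the conventions q_0 = 0, r_0 = 0 (hence beta_0 = 0).  Here alpha_k = q_k . A q_k,
   beta_k = ||r_k|| and q_(k+1) = r_k / beta_k.  Because 1 / 0 = 0 in HOL, the recursion
   is total; if it breaks down at step k (beta_k = 0), then q_(k+1) = 0. *)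
fun lanczos_q :: "real mat \<Rightarrow> real vec \<Rightarrow> nat \<Rightarrow> real vec"
and lanczos_r :: "real mat \<Rightarrow> real vec \<Rightarrow> nat \<Rightarrow> real vec" where
  "lanczos_q A b 0 = 0\<^sub>v (dim_vec b)"
| "lanczos_q A b (Suc 0) = (1 / vec_norm2 (A *\<^sub>v b)) \<cdot>\<^sub>v (A *\<^sub>v b)"
| "lanczos_q A b (Suc (Suc k)) =
     (1 / vec_norm2 (lanczos_r A b (Suc k))) \<cdot>\<^sub>v lanczos_r A b (Suc k)"
| "lanczos_r A b 0 = 0\<^sub>v (dim_vec b)"
| "lanczos_r A b (Suc k) =
     A *\<^sub>v lanczos_q A b (Suc k)
       - (lanczos_q A b (Suc k) \<bullet> (A *\<^sub>v lanczos_q A b (Suc k))) \<cdot>\<^sub>v lanczos_q A b (Suc k)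
       - vec_norm2 (lanczos_r A b k) \<cdot>\<^sub>v lanczos_q A b k"

definition lanczos_alpha :: "real mat \<Rightarrow> real vec \<Rightarrow> nat \<Rightarrow> real" where
  "lanczos_alpha A b k = lanczos_q A b k \<bullet> (A *\<^sub>v lanczos_q A b k)"

definition lanczos_beta :: "real mat \<Rightarrow> real vec \<Rightarrow> nat \<Rightarrow> real" where
  "lanczos_beta A b k = vec_norm2 (lanczos_r A b k)"

definition lanczos_Q :: "real mat \<Rightarrow> real vec \<Rightarrow> nat \<Rightarrow> real mat" where
  "lanczos_Q A b k = mat_of_cols (dim_vec b) (map (lanczos_q A b) [1..<k + 1])"

(* Matrix indices start at 0, whereas alpha and beta are numbered from 1. *)
definition lanczos_T :: "real mat \<Rightarrow> real vec \<Rightarrow> nat \<Rightarrow> real mat" where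
  "lanczos_T A b k = mat (k + 1) k (\<lambda>(i, j).
     if i = j then lanczos_alpha A b (j + 1)
     else if i = j + 1 then lanczos_beta A b (j + 1)
     else if j = i + 1 then lanczos_beta A b (i + 1)
     else 0)"

definition lanczos_gamma :: "real mat \<Rightarrow> real vec \<Rightarrow> nat \<Rightarrow> real" where
  "lanczos_gamma A b k =
     mat_norm2 (A - lanczos_Q A b (k + 1) * lanczos_T A b k * (lanczos_Q A b k)\<^sup>T)"

end

theory Submission
  imports Defs
begin

text \<open>
  Write \<open>M = A - Q\<^bsub>k+1\<^esub> T\<^sub>k Q\<^sub>k\<^sup>T\<close> and \<open>q = q\<^bsub>k+2\<^esub>\<close>.  The Lanczos vectors are mutually
  orthogonal, so \<open>Q\<^sub>k\<^sup>T q = 0\<close> and hence \<open>M q = A q\<close>: the low-rank correction is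
  invisible at \<open>q\<close>.  Since \<open>\<parallel>q\<parallel> \<le> 1\<close>, this gives \<open>\<gamma>\<^sub>k \<ge> \<parallel>A q\<parallel>\<close>, and by the Cauchy-Schwarz
  inequality \<open>\<parallel>A q\<parallel> \<ge> \<bar>q\<^sub>i \<bullet> A q\<bar>\<close> for every \<open>i\<close>.  Taking \<open>i = k + 2\<close> yields \<open>\<bar>\<alpha>\<^bsub>k+2\<^esub>\<bar>\<close>, and
  \<open>i = k + 1\<close> yields \<open>\<beta>\<^bsub>k+1\<^esub>\<close>, because by symmetry
  \<open>q\<^bsub>k+1\<^esub> \<bullet> A q\<^bsub>k+2\<^esub> = A q\<^bsub>k+1\<^esub> \<bullet> q\<^bsub>k+2\<^esub>\<close> and the three-term recurrence expands
  \<open>A q\<^bsub>k+1\<^esub>\<close> in Lanczos vectors.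

  Orthogonality and the recurrence are proved for the totalized recursion: once a residual
  vanishes, all further vectors are zero, so each Lanczos vector is either a unit vector or
  zero, and both properties persist.  The remaining analytic point is that
  the operator norm is the supremum of a bounded set, so that
  \<open>\<parallel>M x\<parallel> \<le> \<parallel>M\<parallel>\<close> for \<open>\<parallel>x\<parallel> \<le> 1\<close>.
\<close>

section \<open>Euclidean and operator norms\<close>

lemma scalar_prod_self_nonneg: "0 \<le> v \<bullet> (v :: real vec)"
  by (simp add: scalar_prod_def sum_nonneg)

lemma scalar_prod_self_eq_0_iff:
  assumes "v \<in> carrier_vec n"
  shows "v \<bullet> (v :: real vec) = 0 \<longleftrightarrow> v = 0\<^sub>v n"
  using assms by (auto simp: scalar_prod_def sum_nonneg_eq_0_iff intro!: eq_vecI)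

lemma vec_norm2_nonneg: "0 \<le> vec_norm2 v"
  by (simp add: vec_norm2_def scalar_prod_self_nonneg)

lemma vec_norm2_square: "vec_norm2 v * vec_norm2 v = v \<bullet> v"
  by (simp add: vec_norm2_def scalar_prod_self_nonneg)

lemma vec_norm2_eq_0_iff:
  assumes "v \<in> carrier_vec n"
  shows "vec_norm2 v = 0 \<longleftrightarrow> v = 0\<^sub>v n"
  using assms by (simp add: vec_norm2_def scalar_prod_self_eq_0_iff)

text \<open>
  Cauchy-Schwarz: the component of \<open>v\<close> orthogonal to \<open>w\<close> has nonnegative squared length.
\<close>

lemma scalar_prod_square_le:
  fixes v w :: "real vec"
  assumes v: "v \<in> carrier_vec n" and w: "w \<in> carrier_vec n"
  shows "(v \<bullet> w)\<^sup>2 \<le> (v \<bullet> v) * (w \<bullet> w)"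
proof (cases "w \<bullet> w = 0")
  case True
  then show ?thesis using v w by (simp add: scalar_prod_self_eq_0_iff)
next
  case False
  then have pos: "0 < w \<bullet> w" using scalar_prod_self_nonneg[of w] by linarith
  define t where "t = (v \<bullet> w) / (w \<bullet> w)"
  have "0 \<le> (v - t \<cdot>\<^sub>v w) \<bullet> (v - t \<cdot>\<^sub>v w)" by (rule scalar_prod_self_nonneg)
  also have "\<dots> = v \<bullet> v - 2 * t * (v \<bullet> w) + t * t * (w \<bullet> w)"
    using v w comm_scalar_prod[OF v w]
    by (simp add: minus_scalar_prod_distrib[of _ n] scalar_prod_minus_distrib[of _ n] algebra_simps)
  also have "\<dots> = v \<bullet> v - (v \<bullet> w)\<^sup>2 / (w \<bullet> w)"
    using False by (simp add: t_def power2_eq_square)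
  finally show ?thesis using pos by (simp add: field_simps)
qed

lemma scalar_prod_le_vec_norm2:
  assumes "v \<in> carrier_vec n" "w \<in> carrier_vec n"
  shows "\<bar>v \<bullet> w\<bar> \<le> vec_norm2 v * vec_norm2 w"
  using real_sqrt_le_mono[OF scalar_prod_square_le[OF assms]]
  by (simp add: vec_norm2_def real_sqrt_mult)

text \<open>
  The supremum defining the operator norm is meaningful because the Euclidean norms of the rows
  of \<open>M\<close> bound the entries of \<open>M x\<close> on the unit ball, so the Frobenius norm of \<open>M\<close> is an upper bound.
\<close>

lemma vec_norm2_mult_le_mat_norm2:
  assumes x: "x \<in> carrier_vec (dim_col M)" and x1: "vec_norm2 x \<le> 1"
  shows "vec_norm2 (M *\<^sub>v x) \<le> mat_norm2 M"
  unfolding mat_norm2_def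
proof (rule cSup_upper)
  show "vec_norm2 (M *\<^sub>v x) \<in> {vec_norm2 (M *\<^sub>v x) |x. x \<in> carrier_vec (dim_col M) \<and> vec_norm2 x \<le> 1}"
    using assms by blast
  let ?C = "sqrt (\<Sum>i<dim_row M. row M i \<bullet> row M i)"
  have "vec_norm2 (M *\<^sub>v y) \<le> ?C"
    if y: "y \<in> carrier_vec (dim_col M)" "vec_norm2 y \<le> 1" for y
  proof -
    have y1: "y \<bullet> y \<le> 1" using y(2) by (simp add: vec_norm2_def)
    have "(row M i \<bullet> y)\<^sup>2 \<le> row M i \<bullet> row M i" for i
    proof -
      have "(row M i \<bullet> y)\<^sup>2 \<le> (row M i \<bullet> row M i) * (y \<bullet> y)"
        using y(1) by (intro scalar_prod_square_le[of _ "dim_col M"]) auto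
      also have "\<dots> \<le> row M i \<bullet> row M i"
        using y1 by (simp add: mult_left_le scalar_prod_self_nonneg)
      finally show ?thesis .
    qed
    moreover have "(M *\<^sub>v y) \<bullet> (M *\<^sub>v y) = (\<Sum>i<dim_row M. (row M i \<bullet> y)\<^sup>2)"
      by (simp add: scalar_prod_def[of "M *\<^sub>v y"] power2_eq_square atLeast0LessThan)
    ultimately show ?thesis
      unfolding vec_norm2_def by (simp add: sum_mono)
  qed
  then show "bdd_above {vec_norm2 (M *\<^sub>v x) |x. x \<in> carrier_vec (dim_col M) \<and> vec_norm2 x \<le> 1}"
    by (intro bdd_aboveI[of _ ?C]) auto
qed

lemma mult_mat_vec_zero:
  assumes "M \<in> carrier_mat nr nc"
  shows "M *\<^sub>v 0\<^sub>v nc = (0\<^sub>v nr :: real vec)"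
  using assms by (intro eq_vecI) (auto simp: scalar_prod_def)

section \<open>The three-term recurrence and orthogonality\<close>

context
  fixes n :: nat and A :: "real mat" and b :: "real vec"
  assumes A: "A \<in> carrier_mat n n"
    and sym: "A\<^sup>T = A"
    and b: "b \<in> carrier_vec n"
begin

lemma lanczos_carrier:
  "lanczos_q A b m \<in> carrier_vec n" "lanczos_r A b m \<in> carrier_vec n"
proof (induction m rule: less_induct)
  case (less m)
  have q: "lanczos_q A b m \<in> carrier_vec n"
  proof (cases m)
    case (Suc j)
    then show ?thesis using A b less by (cases j) auto
  qed (use b in simp)
  show "lanczos_q A b m \<in> carrier_vec n" by (fact q)
  show "lanczos_r A b m \<in> carrier_vec n"
    using A b q less by (cases m) auto
qed

lemma lanczos_q_A_swap:
  "lanczos_q A b i \<bullet> (A *\<^sub>v lanczos_q A b j) = lanczos_q A b j \<bullet> (A *\<^sub>v lanczos_q A b i)"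
proof -
  note q = lanczos_carrier(1)
  have "lanczos_q A b i \<bullet> (A *\<^sub>v lanczos_q A b j) = (A *\<^sub>v lanczos_q A b j) \<bullet> lanczos_q A b i"
    using A q by (intro comm_scalar_prod[of _ n]) auto
  also have "\<dots> = lanczos_q A b j \<bullet> (A *\<^sub>v lanczos_q A b i)"
    using transpose_vec_mult_scalar[OF A q q, of j i] by (simp add: sym)
  finally show ?thesis .
qed

text \<open>
  This holds across a breakdown: a zero residual has \<open>\<beta>\<^sub>m = 0\<close>, so both sides are zero
  whatever the next Lanczos vector is.
\<close>

lemma lanczos_r_eq_beta_smult:
  assumes "1 \<le> m"
  shows "lanczos_r A b m = lanczos_beta A b m \<cdot>\<^sub>v lanczos_q A b (m + 1)"
proof -
  obtain j where j: "m = Suc j" using assms by (cases m) auto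
  show ?thesis
  proof (cases "lanczos_beta A b m = 0")
    case True
    then have "lanczos_r A b m = 0\<^sub>v n"
      using lanczos_carrier(2)[of m] by (simp add: lanczos_beta_def vec_norm2_eq_0_iff)
    then show ?thesis
      using True lanczos_carrier(1)[of "m + 1"] by auto
  next
    case False
    then show ?thesis
      using j by (simp add: lanczos_beta_def smult_smult_assoc del: lanczos_r.simps)
  qed
qed

lemma lanczos_q_eq_0_if_beta_eq_0:
  assumes "1 \<le> m" "lanczos_beta A b m = 0"
  shows "lanczos_q A b (m + 1) = 0\<^sub>v n"
proof -
  obtain j where j: "m = Suc j" using assms by (cases m) auto
  then show ?thesis
    using assms lanczos_carrier(2)[of m]
    by (auto simp: lanczos_beta_def simp del: lanczos_r.simps)
qed

lemma normalized_scalar_prod_self: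
  assumes "w \<in> carrier_vec n" "vec_norm2 w \<noteq> 0"
  shows "((1 / vec_norm2 w) \<cdot>\<^sub>v w) \<bullet> ((1 / vec_norm2 w) \<cdot>\<^sub>v w) = 1"
  using assms by (simp add: vec_norm2_square[of w, symmetric])

lemma lanczos_q_unit_if_beta_neq_0:
  assumes "1 \<le> m" "lanczos_beta A b m \<noteq> 0"
  shows "lanczos_q A b (m + 1) \<bullet> lanczos_q A b (m + 1) = 1"
proof -
  obtain j where j: "m = Suc j" using assms by (cases m) auto
  then have "lanczos_q A b (m + 1) = (1 / vec_norm2 (lanczos_r A b m)) \<cdot>\<^sub>v lanczos_r A b m"
    by simp
  then show ?thesis
    using assms normalized_scalar_prod_self[OF lanczos_carrier(2)[of m]]
    by (simp only: lanczos_beta_def not_False_eq_True)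
qed

lemma lanczos_q_zero_or_unit:
  "lanczos_q A b m = 0\<^sub>v n \<or> lanczos_q A b m \<bullet> lanczos_q A b m = 1"
proof (cases m)
  case 0
  then show ?thesis using b by auto
next
  case (Suc j)
  show ?thesis
  proof (cases j)
    case 0
    show ?thesis
    proof (cases "vec_norm2 (A *\<^sub>v b) = 0")
      case True
      then show ?thesis using Suc 0 A b by (auto intro!: eq_vecI)
    next
      case False
      then have "lanczos_q A b m \<bullet> lanczos_q A b m = 1"
        using Suc 0 normalized_scalar_prod_self[OF mult_mat_vec_carrier[OF A b]]
        by (simp only: lanczos_q.simps not_False_eq_True)
      then show ?thesis ..
    qed
  next
    case (Suc l)
    then show ?thesis
      using \<open>m = Suc j\<close> lanczos_q_eq_0_if_beta_eq_0[of j] lanczos_q_unit_if_beta_neq_0[of j]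
      by auto
  qed
qed

lemma vec_norm2_lanczos_q_le_1: "vec_norm2 (lanczos_q A b m) \<le> 1"
  using lanczos_q_zero_or_unit[of m] by (auto simp: vec_norm2_def)

lemma scalar_prod_lanczos_r:
  assumes x: "x \<in> carrier_vec n"
  shows "x \<bullet> lanczos_r A b (Suc m) = x \<bullet> (A *\<^sub>v lanczos_q A b (Suc m))
    - lanczos_alpha A b (Suc m) * (x \<bullet> lanczos_q A b (Suc m))
    - lanczos_beta A b m * (x \<bullet> lanczos_q A b m)"
proof -
  note q = lanczos_carrier(1)
  have Aq: "A *\<^sub>v lanczos_q A b (Suc m) \<in> carrier_vec n" using A q by auto
  show ?thesis
    unfolding lanczos_r.simps lanczos_alpha_def[symmetric] lanczos_beta_def[symmetric]
    using x Aq q[of m] q[of "Suc m"]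
    by (simp add: scalar_prod_minus_distrib[of _ n] scalar_prod_smult_distrib[of _ n])
qed

lemma lanczos_three_term:
  assumes x: "x \<in> carrier_vec n"
  shows "x \<bullet> (A *\<^sub>v lanczos_q A b (Suc m)) =
    lanczos_beta A b (Suc m) * (x \<bullet> lanczos_q A b (Suc (Suc m)))
    + lanczos_alpha A b (Suc m) * (x \<bullet> lanczos_q A b (Suc m))
    + lanczos_beta A b m * (x \<bullet> lanczos_q A b m)"
  using scalar_prod_lanczos_r[OF x, of m] lanczos_r_eq_beta_smult[of "Suc m"]
    x lanczos_carrier(1)[of "Suc (Suc m)"]
  by (simp add: scalar_prod_smult_distrib[of _ n] del: lanczos_r.simps lanczos_q.simps)

text \<open>
  Breakdown propagates: for \<open>m > 1\<close> the zero vector can only arise from a zero residual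
  \<open>r\<^bsub>m-1\<^esub>\<close>, so both subtracted terms of \<open>r\<^sub>m\<close> vanish together with \<open>A q\<^sub>m\<close>.  For \<open>m = 1\<close> the convention \<open>\<beta>\<^sub>0 = 0\<close> does the same.
\<close>

lemma lanczos_beta_eq_0_if_q_eq_0:
  assumes "1 \<le> m" "lanczos_q A b m = 0\<^sub>v n"
  shows "lanczos_beta A b m = 0"
proof -
  obtain j where j: "m = Suc j" using assms by (cases m) auto
  have "lanczos_beta A b j = 0"
  proof (cases j)
    case 0
    then show ?thesis using b by (simp add: lanczos_beta_def vec_norm2_def)
  next
    case (Suc l)
    then show ?thesis using lanczos_q_unit_if_beta_neq_0[of j] assms j
      by (auto simp del: lanczos_q.simps lanczos_r.simps)
  qed
  then have "lanczos_r A b m \<bullet> lanczos_r A b m = 0"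
    using scalar_prod_lanczos_r[OF lanczos_carrier(2)[of m], of j] assms(2) j
      lanczos_carrier(2)[of m] mult_mat_vec_zero[OF A]
    by (simp del: lanczos_r.simps lanczos_q.simps)
  then show ?thesis by (simp add: lanczos_beta_def vec_norm2_def)
qed

text \<open>
  The induction is the classical one: \<open>q\<^sub>i \<bullet> r\<^sub>m\<close> vanishes for \<open>i = m\<close> by the choice of
  \<open>\<alpha>\<^sub>m\<close>, for \<open>i = m - 1\<close> because symmetry makes the superdiagonal coefficient equal to
  \<open>\<beta>\<^bsub>m-1\<^esub>\<close>, and for smaller \<open>i\<close> because \<open>A q\<^sub>i\<close> only involves Lanczos
  vectors of index below \<open>m\<close>.  Dividing by \<open>\<beta>\<^sub>m\<close> gives the claim for \<open>q\<^bsub>m+1\<^esub>\<close>, which is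
  zero if \<open>\<beta>\<^sub>m\<close> is.
\<close>

lemma lanczos_q_orthogonal:
  assumes "i < j"
  shows "lanczos_q A b i \<bullet> lanczos_q A b j = 0"
  using assms
proof (induction j arbitrary: i rule: less_induct)
  case (less j)
  note q = lanczos_carrier(1)
  note orth = less.IH
  note [simp del] = lanczos_q.simps lanczos_r.simps
  have comm: "lanczos_q A b s \<bullet> lanczos_q A b t = lanczos_q A b t \<bullet> lanczos_q A b s" for s t
    using comm_scalar_prod q by blast
  show ?case
  proof (cases i)
    case 0
    then show ?thesis using b q[of j] by (simp add: lanczos_q.simps(1))
  next
    case (Suc i')
    then obtain m where j: "j = Suc (Suc m)" and i: "i \<le> Suc m"
      using less.prems by (cases j; cases "j - 1") auto
    have "lanczos_beta A b (Suc m) * (lanczos_q A b i \<bullet> lanczos_q A b j)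
      = lanczos_q A b i \<bullet> (A *\<^sub>v lanczos_q A b (Suc m))
        - lanczos_alpha A b (Suc m) * (lanczos_q A b i \<bullet> lanczos_q A b (Suc m))
        - lanczos_beta A b m * (lanczos_q A b i \<bullet> lanczos_q A b m)"
      using lanczos_three_term[OF q, of i m] j by simp
    also have "\<dots> = 0"
    proof -
      consider "i = Suc m" | "i = m" | "i < m" using i by linarith
      then show ?thesis
      proof cases
        case 1
        have "lanczos_q A b i \<bullet> lanczos_q A b m = 0"
          using orth[of "Suc m" m] 1 j comm by simp
        moreover have "lanczos_alpha A b i * (lanczos_q A b i \<bullet> lanczos_q A b i) = lanczos_alpha A b i"
          using lanczos_q_zero_or_unit[of i] A q[of i] by (auto simp: lanczos_alpha_def)
        ultimately show ?thesis using 1 by (simp add: lanczos_alpha_def)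
      next
        case 2
        have "lanczos_q A b i \<bullet> (A *\<^sub>v lanczos_q A b (Suc m))
          = lanczos_q A b (Suc m) \<bullet> (A *\<^sub>v lanczos_q A b i)"
          by (rule lanczos_q_A_swap)
        also have "\<dots> = lanczos_beta A b m * (lanczos_q A b (Suc m) \<bullet> lanczos_q A b (Suc m))"
          using lanczos_three_term[OF q, of "Suc m" i'] orth[of "Suc m" m] orth[of "Suc m" i']
            2 Suc j comm by simp
        also have "\<dots> = lanczos_beta A b m * (lanczos_q A b m \<bullet> lanczos_q A b m)"
          \<comment> \<open>If \<open>\<beta>\<^sub>m\<close> is nonzero, both are unit vectors, as \<open>q\<^sub>m = 0\<close> would force \<open>\<beta>\<^sub>m = 0\<close>.\<close>
          using lanczos_q_unit_if_beta_neq_0[of m] lanczos_q_zero_or_unit[of m]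
            lanczos_beta_eq_0_if_q_eq_0[of m] 2 Suc by (cases "lanczos_beta A b m = 0") auto
        finally show ?thesis using orth[of "Suc m" m] 2 j by simp
      next
        case 3
        have "lanczos_q A b i \<bullet> (A *\<^sub>v lanczos_q A b (Suc m))
          = lanczos_q A b (Suc m) \<bullet> (A *\<^sub>v lanczos_q A b i)"
          by (rule lanczos_q_A_swap)
        also have "\<dots> = 0"
          using lanczos_three_term[OF q, of "Suc m" i'] orth[of "Suc m" "Suc i"] orth[of "Suc m" i]
            orth[of "Suc m" i'] 3 Suc j comm by simp
        finally show ?thesis using orth[of "Suc m" i] orth[of m i] 3 j by simp
      qed
    qed
    finally have "lanczos_beta A b (Suc m) = 0 \<or> lanczos_q A b i \<bullet> lanczos_q A b j = 0" by simp
    then show ?thesis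
      using lanczos_q_eq_0_if_beta_eq_0[of "Suc m"] q[of i] j by auto
  qed
qed

text \<open>
  By symmetry this is the coefficient of \<open>q\<^bsub>m+2\<^esub>\<close> in the expansion of \<open>A q\<^bsub>m+1\<^esub>\<close>.  If
  \<open>q\<^bsub>m+2\<^esub>\<close> is not a unit vector, that coefficient is zero.
\<close>

lemma lanczos_q_scalar_prod_A_next:
  "lanczos_q A b (Suc m) \<bullet> (A *\<^sub>v lanczos_q A b (Suc (Suc m))) = lanczos_beta A b (Suc m)"
proof -
  note q = lanczos_carrier(1)
  let ?x = "lanczos_q A b (Suc (Suc m))"
  have orth: "?x \<bullet> lanczos_q A b i = 0" if "i < Suc (Suc m)" for i
    using comm_scalar_prod[OF q q] lanczos_q_orthogonal[OF that] by metis
  have "lanczos_q A b (Suc m) \<bullet> (A *\<^sub>v ?x) = ?x \<bullet> (A *\<^sub>v lanczos_q A b (Suc m))"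
    by (rule lanczos_q_A_swap)
  also have "\<dots> = lanczos_beta A b (Suc m) * (?x \<bullet> ?x)"
    using lanczos_three_term[OF q, of "Suc (Suc m)" m]
    by (simp add: orth del: lanczos_q.simps)
  also have "\<dots> = lanczos_beta A b (Suc m)"
    using lanczos_q_unit_if_beta_neq_0[of "Suc m"] by (cases "lanczos_beta A b (Suc m) = 0") auto
  finally show ?thesis .
qed

section \<open>The approximation error seen by later Lanczos vectors\<close>

lemma transpose_lanczos_Q_mult_later_q:
  assumes "k < m"
  shows "(lanczos_Q A b k)\<^sup>T *\<^sub>v lanczos_q A b m = 0\<^sub>v k"
proof (rule eq_vecI)
  fix i assume "i < dim_vec (0\<^sub>v k :: real vec)"
  then have i: "i < k" by simp
  then have nth: "map (lanczos_q A b) [1..<k + 1] ! i = lanczos_q A b (Suc i)"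
    by (simp del: upt_Suc)
  have "col (lanczos_Q A b k) i = lanczos_q A b (Suc i)"
    unfolding lanczos_Q_def using i b nth lanczos_carrier(1)[of "Suc i"]
    by (subst col_mat_of_cols) (auto simp del: upt_Suc)
  then show "((lanczos_Q A b k)\<^sup>T *\<^sub>v lanczos_q A b m) $ i = 0\<^sub>v k $ i"
    using i assms lanczos_q_orthogonal[of "Suc i" m] by (simp add: lanczos_Q_def)
qed (simp add: lanczos_Q_def)

text \<open>
  The correction \<open>Q\<^bsub>k+1\<^esub> T\<^sub>k Q\<^sub>k\<^sup>T\<close> annihilates \<open>q\<^sub>m\<close>, so \<open>A q\<^sub>m\<close> is an image of a vector
  of norm at most one under the error matrix.
\<close>

lemma norm_A_lanczos_q_le_gamma:
  assumes "k < m"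
  shows "vec_norm2 (A *\<^sub>v lanczos_q A b m) \<le> lanczos_gamma A b k"
proof -
  let ?x = "lanczos_q A b m"
  let ?QT = "lanczos_Q A b (k + 1) * lanczos_T A b k"
  let ?M = "A - ?QT * (lanczos_Q A b k)\<^sup>T"
  have x: "?x \<in> carrier_vec n" by (rule lanczos_carrier)
  have Q: "lanczos_Q A b j \<in> carrier_mat n j" for j
    unfolding lanczos_Q_def using b mat_of_cols_carrier(1)[of "dim_vec b"
      "map (lanczos_q A b) [1..<j + 1]"] by (simp del: upt_Suc)
  have T: "lanczos_T A b k \<in> carrier_mat (k + 1) k" by (simp add: lanczos_T_def)
  have QT: "?QT \<in> carrier_mat n k" using Q T by (rule mult_carrier_mat)
  have Qt: "(lanczos_Q A b k)\<^sup>T \<in> carrier_mat k n" using Q by simp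
  have "(?QT * (lanczos_Q A b k)\<^sup>T) *\<^sub>v ?x = ?QT *\<^sub>v 0\<^sub>v k"
    using assoc_mult_mat_vec[OF QT Qt x] transpose_lanczos_Q_mult_later_q[OF assms] by simp
  also have "\<dots> = 0\<^sub>v n" by (rule mult_mat_vec_zero[OF QT])
  finally have "?M *\<^sub>v ?x = A *\<^sub>v ?x"
    using minus_mult_distrib_mat_vec[OF A mult_carrier_mat[OF QT Qt] x] A by auto
  moreover have "vec_norm2 (?M *\<^sub>v ?x) \<le> mat_norm2 ?M"
    using x Qt vec_norm2_lanczos_q_le_1[of m] by (intro vec_norm2_mult_le_mat_norm2) auto
  ultimately show ?thesis by (simp add: lanczos_gamma_def)
qed

lemma scalar_prod_A_lanczos_q_le_gamma:
  assumes "k < m"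
  shows "\<bar>lanczos_q A b i \<bullet> (A *\<^sub>v lanczos_q A b m)\<bar> \<le> lanczos_gamma A b k"
proof -
  have "\<bar>lanczos_q A b i \<bullet> (A *\<^sub>v lanczos_q A b m)\<bar>
    \<le> vec_norm2 (lanczos_q A b i) * vec_norm2 (A *\<^sub>v lanczos_q A b m)"
    using A lanczos_carrier(1) by (intro scalar_prod_le_vec_norm2[of _ n]) auto
  also have "\<dots> \<le> vec_norm2 (A *\<^sub>v lanczos_q A b m)"
    using vec_norm2_lanczos_q_le_1[of i] by (simp add: mult_left_le_one_le vec_norm2_nonneg)
  also have "\<dots> \<le> lanczos_gamma A b k" by (rule norm_A_lanczos_q_le_gamma[OF assms])
  finally show ?thesis .
qed

end

theorem theorem5p3:
  fixes n :: nat and A :: "real mat" and b :: "real vec"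
    and v :: "nat \<Rightarrow> real vec" and ev :: "nat \<Rightarrow> real"
  assumes A: "A \<in> carrier_mat n n"
    and sym: "A\<^sup>T = A"
    and b: "b \<in> carrier_vec n"
    and eig: "\<And>j. j \<in> {1..n} \<Longrightarrow> eigenvector A (v j) (ev j)"
    and orthonormal: "\<And>i j. i \<in> {1..n} \<Longrightarrow> j \<in> {1..n} \<Longrightarrow> v i \<bullet> v j = (if i = j then 1 else 0)"
    and decreasing: "\<And>i j. 1 \<le> i \<Longrightarrow> i < j \<Longrightarrow> j \<le> n \<Longrightarrow> \<bar>ev j\<bar> < \<bar>ev i\<bar>"
    and nonzero: "\<And>j. j \<in> {1..n} \<Longrightarrow> \<bar>ev j\<bar> > 0"
    and b_comp: "\<And>j. j \<in> {1..n} \<Longrightarrow> v j \<bullet> b \<noteq> 0"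
    and k: "1 \<le> k" "k + 2 \<le> n"
  shows "lanczos_beta A b (k + 1) \<le> lanczos_gamma A b k
       \<and> \<bar>lanczos_alpha A b (k + 2)\<bar> \<le> lanczos_gamma A b k"
proof
  have bound: "\<bar>lanczos_q A b i \<bullet> (A *\<^sub>v lanczos_q A b (k + 2))\<bar> \<le> lanczos_gamma A b k" for i
    using scalar_prod_A_lanczos_q_le_gamma[OF A sym b, of k "k + 2" i] by simp
  show "lanczos_beta A b (k + 1) \<le> lanczos_gamma A b k"
    using bound[of "k + 1"] lanczos_q_scalar_prod_A_next[OF A sym b, of k]
    by (simp del: lanczos_q.simps)
  show "\<bar>lanczos_alpha A b (k + 2)\<bar> \<le> lanczos_gamma A b k"
    using bound[of "k + 2"] by (simp only: lanczos_alpha_def)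
qed

end
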